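(* Let $\mathcal{X}$ be a finite nonempty set, let $\beta$ be a nonzero real number, and let $\phi_0,\phi:\mathcal{X}\to\mathbb{R}$. Let $p_0$ and $p$ be the Gibbs measures on $\mathcal{X}$ with potentials $\phi_0$ and $\phi$, respectively, and resource parameter $\beta$. Let $F_0$ and $F$ be the free energies of $p_0$ (for the potential $\phi_0$) and of $p$ (for the potential $\phi$), respectively. Then the negative free energy difference $-\Delta F = F_0-F$ is $$-\Delta F=\sum_{x\in\mathcal{X}}p(x)U(x)-\frac{1}{\beta}\sum_{x\in\mathcal{X}}p(x)\log\frac{p(x)}{p_0(x)},$$ where $U(x)=\phi_0(x)-\phi(x)$.
   Context: The Gibbs measure on $\mathcal{X}$ with potential $\psi:\mathcal{X}\to\mathbb{R}$ and resource parameter $\beta$ is the probability distribution $x\mapsto e^{-\beta\psi(x)}/\sum_{x'\in\mathcal{X}}e^{-\beta\psi(x')}$. The free energy for the potential $\psi$ of a probability distribution $q$ on $\mathcal{X}$ is $$\sum_{x\in\mathcal{X}}q(x)\psi(x)+\frac{1}{\beta}\sum_{x\in\mathcal{X}}q(x)\log q(x),$$ with $0\log 0=0$ and $\log$ the natural logarithm. Thus $F_0=\sum_x p_0(x)\phi_0(x)+\frac1\beta\sum_x p_0(x)\log p_0(x)$ and $F=\sum_x p(x)\phi(x)+\frac1\beta\sum_x p(x)\log p(x)$. *)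

theory Defs
  imports Complex_Main
begin

(* A probability distribution on a finite set X is represented by its mass function
   'a => real; only the values on X are meaningful. *)

definition gibbs_measure :: "'a set \<Rightarrow> real \<Rightarrow> ('a \<Rightarrow> real) \<Rightarrow> 'a \<Rightarrow> real" where
  "gibbs_measure X \<beta> \<psi> x = exp (- \<beta> * \<psi> x) / (\<Sum>x'\<in>X. exp (- \<beta> * \<psi> x'))"

(* The convention 0 log 0 = 0 holds automatically, as ln is a total function. *)

definition free_energy :: "'a set \<Rightarrow> real \<Rightarrow> ('a \<Rightarrow> real) \<Rightarrow> ('a \<Rightarrow> real) \<Rightarrow> real" where
  "free_energy X \<beta> \<psi> q = (\<Sum>x\<in>X. q x * \<psi> x) + 1 / \<beta> * (\<Sum>x\<in>X. q x * ln (q x))"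

lemma gibbs_measure_pos:
  assumes "finite X" and "X \<noteq> {}"
  shows "gibbs_measure X \<beta> \<psi> x > 0"
  using assms by (simp add: gibbs_measure_def sum_pos)

lemma sum_gibbs_measure:
  assumes "finite X" and "X \<noteq> {}"
  shows "(\<Sum>x\<in>X. gibbs_measure X \<beta> \<psi> x) = 1"
proof -
  have "(\<Sum>x\<in>X. exp (- \<beta> * \<psi> x)) > 0"
    using assms by (intro sum_pos) auto
  then show ?thesis
    by (simp add: gibbs_measure_def flip: sum_divide_distrib)
qed

end

theory Submission
  imports Defs
begin

text \<open>
  For a Gibbs measure \<open>p\<^sub>0\<close> with potential \<open>\<phi>\<^sub>0\<close>, the integrand \<open>\<phi>\<^sub>0 x + ln (p\<^sub>0 x) / \<beta>\<close> of its free
  energy does not depend on \<open>x\<close>: energy and log-probability balance at every point, leaving only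
  the log-partition function (\<open>gibbs_measure_balance\<close>). The average of a constant is the same under
  every distribution, so \<open>F\<^sub>0\<close> may be computed by averaging over \<open>p\<close> instead of \<open>p\<^sub>0\<close>
  (\<open>free_energy_gibbs_measure_average\<close>). Then \<open>F\<^sub>0\<close> and \<open>F\<close> are averages over the same
  distribution and can be subtracted pointwise: the potentials give \<open>U\<close>, and the logarithms give
  the log-ratio.
\<close>

lemma gibbs_measure_balance:
  assumes "finite X" and "X \<noteq> {}" and "\<beta> \<noteq> 0"
  shows "\<psi> x + 1 / \<beta> * ln (gibbs_measure X \<beta> \<psi> x) = - (1 / \<beta>) * ln (\<Sum>x'\<in>X. exp (- \<beta> * \<psi> x'))"
proof -
  have "(\<Sum>x'\<in>X. exp (- \<beta> * \<psi> x')) > 0"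
    using assms by (intro sum_pos) auto
  then have "ln (gibbs_measure X \<beta> \<psi> x) = - \<beta> * \<psi> x - ln (\<Sum>x'\<in>X. exp (- \<beta> * \<psi> x'))"
    unfolding gibbs_measure_def by (subst ln_div) auto
  then show ?thesis
    using \<open>\<beta> \<noteq> 0\<close> by (simp only:) (simp add: field_simps)
qed

text \<open>
  Under the logarithm the Gibbs measure stays fixed while the averaging distribution \<open>q\<close> varies.
  Since the averaged quantity is constant, only the total mass of \<open>q\<close> matters; taking \<open>q\<close> to be the
  Gibbs measure itself identifies the common value as its free energy.
\<close>

lemma free_energy_gibbs_measure_average:
  assumes "finite X" and "X \<noteq> {}" and "\<beta> \<noteq> 0" and q: "(\<Sum>x\<in>X. q x) = 1"
  shows "(\<Sum>x\<in>X. q x * \<psi> x) + 1 / \<beta> * (\<Sum>x\<in>X. q x * ln (gibbs_measure X \<beta> \<psi> x))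
    = free_energy X \<beta> \<psi> (gibbs_measure X \<beta> \<psi>)"
proof -
  let ?g = "gibbs_measure X \<beta> \<psi>"
  let ?c = "- (1 / \<beta>) * ln (\<Sum>x'\<in>X. exp (- \<beta> * \<psi> x'))"
  have const: "(\<Sum>x\<in>X. r x * \<psi> x) + 1 / \<beta> * (\<Sum>x\<in>X. r x * ln (?g x)) = ?c"
    if "(\<Sum>x\<in>X. r x) = 1" for r
  proof -
    have "(\<Sum>x\<in>X. r x * \<psi> x) + 1 / \<beta> * (\<Sum>x\<in>X. r x * ln (?g x))
      = (\<Sum>x\<in>X. r x * (\<psi> x + 1 / \<beta> * ln (?g x)))"
      by (simp add: sum.distrib sum_distrib_left distrib_left mult.left_commute)
    also have "\<dots> = (\<Sum>x\<in>X. r x * ?c)"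
      by (simp only: gibbs_measure_balance[OF assms(1-3)])
    also have "\<dots> = ?c"
      using that by (simp only: mult_1 flip: sum_distrib_right)
    finally show ?thesis .
  qed
  show ?thesis
    unfolding free_energy_def const[OF q] const[OF sum_gibbs_measure[OF assms(1,2)]] ..
qed

theorem theorem2:
  fixes X :: "'a set" and \<beta> F\<^sub>0 F :: real
    and \<phi>\<^sub>0 \<phi> p\<^sub>0 p U :: "'a \<Rightarrow> real"
  assumes "finite X" and "X \<noteq> {}" and "\<beta> \<noteq> 0"
    and "\<And>x. x \<in> X \<Longrightarrow> p\<^sub>0 x = gibbs_measure X \<beta> \<phi>\<^sub>0 x"
    and "\<And>x. x \<in> X \<Longrightarrow> p x = gibbs_measure X \<beta> \<phi> x"
    and "F\<^sub>0 = free_energy X \<beta> \<phi>\<^sub>0 p\<^sub>0"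
    and "F = free_energy X \<beta> \<phi> p"
    and "\<And>x. x \<in> X \<Longrightarrow> U x = \<phi>\<^sub>0 x - \<phi> x"
  shows "F\<^sub>0 - F = (\<Sum>x\<in>X. p x * U x) - 1 / \<beta> * (\<Sum>x\<in>X. p x * ln (p x / p\<^sub>0 x))"
proof -
  let ?g\<^sub>0 = "gibbs_measure X \<beta> \<phi>\<^sub>0"
  have p_sum: "(\<Sum>x\<in>X. p x) = 1"
    using sum_gibbs_measure[OF assms(1,2), of \<beta> \<phi>] assms(5) by simp
  have "F\<^sub>0 = free_energy X \<beta> \<phi>\<^sub>0 ?g\<^sub>0"
    using assms(4,6) by (simp add: free_energy_def)
  also have "\<dots> = (\<Sum>x\<in>X. p x * \<phi>\<^sub>0 x) + 1 / \<beta> * (\<Sum>x\<in>X. p x * ln (?g\<^sub>0 x))"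
    using free_energy_gibbs_measure_average[OF assms(1-3) p_sum] by simp
  finally have F\<^sub>0: "F\<^sub>0 = (\<Sum>x\<in>X. p x * \<phi>\<^sub>0 x) + 1 / \<beta> * (\<Sum>x\<in>X. p x * ln (p\<^sub>0 x))"
    using assms(4) by simp
  have U: "(\<Sum>x\<in>X. p x * U x) = (\<Sum>x\<in>X. p x * \<phi>\<^sub>0 x) - (\<Sum>x\<in>X. p x * \<phi> x)"
    using assms(8) by (simp add: right_diff_distrib sum_subtractf)
  have "ln (p x / p\<^sub>0 x) = ln (p x) - ln (p\<^sub>0 x)" if "x \<in> X" for x
    using gibbs_measure_pos[OF assms(1,2)] assms(4,5)[OF that]
    by (simp add: ln_div less_imp_neq[symmetric])
  then have "(\<Sum>x\<in>X. p x * ln (p x / p\<^sub>0 x))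
      = (\<Sum>x\<in>X. p x * ln (p x)) - (\<Sum>x\<in>X. p x * ln (p\<^sub>0 x))"
    by (simp add: right_diff_distrib sum_subtractf)
  then show ?thesis
    unfolding F\<^sub>0 assms(7) free_energy_def U by (simp add: right_diff_distrib diff_divide_distrib)
qed

end
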